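(* For all integers $k\ge0$ and $n\ge0$, $$F_{2n}^{\delta_k}=(x+y)^n,\qquad F_{2n+1}^{\delta_k}=\begin{cases}(x+y)^n,& k\equiv0\pmod 4,\\ (x+y)^{n+1},& k\equiv1\pmod4,\\ xyz(x+y)^n,& k\equiv 2\pmod 4,\\ 0,& k\equiv 3\pmod 4.\end{cases}$$
   Context: $\delta_k=(k,k-1,\dots,1)$ (with $\delta_0=\emptyset$). Partitions are identified with Young diagrams (cell $(i,j)$ in row $i$, column $j$); for $\mu\subseteq\lambda$, $\lambda/\mu$ is the set of cells of $\lambda$ not in $\mu$, $\lambda/\mu\vdash n$ means it has $n$ cells. $v(\lambda/\mu)$, $h(\lambda/\mu)$, $d(\lambda/\mu)$ are the numbers of cells of $\lambda/\mu$ in even rows, in even columns, and in both even rows and even columns. A standard Young tableau (SYT) of shape $\lambda/\mu\vdash n$ is a bijection $T$ from its cells to $[n]$ with $T(i,j)\le T(i',j')$ whenever $i\le i',j\le j'$. For cells write $(i,j)\lhd(i',j')$ if $i<i'$ or ($i=i'$ and $j<j'$). For a SYT $T$ of straight shape $\lambda$, ${\rm sign}(T)=(-1)^{{\rm inv}(T)}$ with ${\rm inv}(T)=\#\{(a,b):a\lhd b,\ T(a)>T(b)\}$. For $T_1$ an SYT of shape $\nu/\mu\vdash k$ and $T_2$ of shape $\lambda/\nu$, $T_1\diamond T_2$ is the SYT of shape $\lambda/\mu$ equal to $T_1$ on $\nu/\mu$ and $T_2+k$ on $\lambda/\nu$. For an SYT $T$ of shape $\lambda/\mu$, ${\rm sign}(T)={\rm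 sign}(T_0){\rm sign}(T_0\diamond T)$ for any SYT $T_0$ of shape $\mu$ (independent of $T_0$). $I_{\lambda/\mu}=\sum_T{\rm sign}(T)$ over SYTs of shape $\lambda/\mu$. For a partition $\alpha$ and $n\ge0$, $F_n^\alpha=\sum_{\lambda:\ \lambda/\alpha\vdash n}x^{v(\lambda/\alpha)}y^{h(\lambda/\alpha)}z^{d(\lambda/\alpha)}I_{\lambda/\alpha}$. *)

theory Defs
  imports Main "HOL-Library.FuncSet"
begin

definition partition :: "nat list \<Rightarrow> bool" where
  "partition \<rho> \<longleftrightarrow> sorted_wrt (\<ge>) \<rho> \<and> 0 \<notin> set \<rho>"

text \<open>Cells \<open>(i, j)\<close> are 1-based: row \<open>i\<close>, column \<open>j\<close>.\<close>

definition diagram :: "nat list \<Rightarrow> (nat \<times> nat) set" where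
  "diagram \<rho> = {(i, j). 1 \<le> i \<and> i \<le> length \<rho> \<and> 1 \<le> j \<and> j \<le> \<rho> ! (i - 1)}"

definition skew :: "nat list \<Rightarrow> nat list \<Rightarrow> (nat \<times> nat) set" where
  "skew \<rho> \<mu> = diagram \<rho> - diagram \<mu>"

definition staircase :: "nat \<Rightarrow> nat list" where
  "staircase k = rev [1..<Suc k]"

definition v_stat :: "(nat \<times> nat) set \<Rightarrow> nat" where
  "v_stat S = card {(i, j) \<in> S. even i}"

definition h_stat :: "(nat \<times> nat) set \<Rightarrow> nat" where
  "h_stat S = card {(i, j) \<in> S. even j}"

definition d_stat :: "(nat \<times> nat) set \<Rightarrow> nat" where
  "d_stat S = card {(i, j) \<in> S. even i \<and> even j}"

text \<open>Fillings are made \<^const>\<open>extensional\<close> so that each tableau is represented by exactly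
  one function.\<close>

definition SYT :: "(nat \<times> nat) set \<Rightarrow> (nat \<times> nat \<Rightarrow> nat) set" where
  "SYT S = {T \<in> extensional S. bij_betw T S {1..card S} \<and>
     (\<forall>i j i' j'. (i, j) \<in> S \<longrightarrow> (i', j') \<in> S \<longrightarrow> i \<le> i' \<longrightarrow> j \<le> j' \<longrightarrow> T (i, j) \<le> T (i', j'))}"

fun reading_less :: "nat \<times> nat \<Rightarrow> nat \<times> nat \<Rightarrow> bool" (infix "\<lhd>" 50) where
  "(i, j) \<lhd> (i', j') \<longleftrightarrow> i < i' \<or> (i = i' \<and> j < j')"

definition inversions :: "nat list \<Rightarrow> (nat \<times> nat \<Rightarrow> nat) \<Rightarrow> nat" where
  "inversions \<rho> T = card {(a, b). a \<in> diagram \<rho> \<and> b \<in> diagram \<rho> \<and> a \<lhd> b \<and> T a > T b}"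

definition straight_sign :: "nat list \<Rightarrow> (nat \<times> nat \<Rightarrow> nat) \<Rightarrow> int" where
  "straight_sign \<rho> T = (-1) ^ inversions \<rho> T"

text \<open>\<open>T\<^sub>1\<close> has shape \<open>\<nu>/\<mu>\<close>, \<open>T\<^sub>2\<close> has shape \<open>\<rho>/\<nu>\<close>, the result has shape \<open>\<rho>/\<mu>\<close>.\<close>

definition diamond ::
  "nat list \<Rightarrow> nat list \<Rightarrow> nat list \<Rightarrow> (nat \<times> nat \<Rightarrow> nat) \<Rightarrow> (nat \<times> nat \<Rightarrow> nat) \<Rightarrow> (nat \<times> nat \<Rightarrow> nat)"
  where
  "diamond \<rho> \<nu> \<mu> T\<^sub>1 T\<^sub>2 =
     restrict (\<lambda>c. if c \<in> skew \<nu> \<mu> then T\<^sub>1 c else T\<^sub>2 c + card (skew \<nu> \<mu>)) (skew \<rho> \<mu>)"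

text \<open>The value does not depend on the auxiliary tableau \<open>T\<^sub>0\<close> of shape \<open>\<mu>\<close>; an arbitrary one
  is chosen.\<close>

definition skew_sign :: "nat list \<Rightarrow> nat list \<Rightarrow> (nat \<times> nat \<Rightarrow> nat) \<Rightarrow> int" where
  "skew_sign \<rho> \<mu> T =
     (let T\<^sub>0 = (SOME T\<^sub>0. T\<^sub>0 \<in> SYT (diagram \<mu>))
      in straight_sign \<mu> T\<^sub>0 * straight_sign \<rho> (diamond \<rho> \<mu> [] T\<^sub>0 T))"

definition sign_imbalance :: "nat list \<Rightarrow> nat list \<Rightarrow> int" where
  "sign_imbalance \<rho> \<mu> = (\<Sum>T\<in>SYT (skew \<rho> \<mu>). skew_sign \<rho> \<mu> T)"

text \<open>The indeterminates are arbitrary elements of an arbitrary commutative ring; taking the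
  generators of a polynomial ring over the integers gives the formal generating polynomial.\<close>

definition F_poly :: "nat list \<Rightarrow> nat \<Rightarrow> 'a \<Rightarrow> 'a \<Rightarrow> 'a \<Rightarrow> 'a::comm_ring_1" where
  "F_poly \<alpha> n x y z =
     (\<Sum>\<rho> | partition \<rho> \<and> diagram \<alpha> \<subseteq> diagram \<rho> \<and> card (skew \<rho> \<alpha>) = n.
        x ^ v_stat (skew \<rho> \<alpha>) * y ^ h_stat (skew \<rho> \<alpha>) * z ^ d_stat (skew \<rho> \<alpha>) *
        of_int (sign_imbalance \<rho> \<alpha>))"

end

theory Submission imports Defs begin

text \<open>
  Let \<open>U\<close> act on functions of partitions by summing over all ways to add a cell, with the weight
  of the cell and the sign \<open>(-1)^m\<close>, where \<open>m\<close> is the number of cells in lower rows. Removing the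
  largest entry of a tableau shows that \<open>F_n^\<alpha> = (U^n 1)(\<alpha>)\<close>. Let \<open>D\<close> be the analogous operator
  removing cells, with the complementary weights \<open>1, y, -x, -xyz\<close> for cells in rows and columns of
  parity even-even, even-odd, odd-even, odd-odd. Off the diagonal the signs make \<open>U\<close> and \<open>D\<close>
  anticommute, and the diagonal terms telescope: \<open>UD + DU = -xyz\<close>. Hence \<open>D\<^sup>2\<close> commutes with \<open>U\<close>.
  The operators \<open>U\<^sup>2\<close> and \<open>D\<^sup>2\<close> add and remove signed dominoes, and \<open>U\<^sup>2 1 = D\<^sup>2 1 + (x + y)\<close>,
  again by telescoping. No domino can be removed from a staircase, so \<open>D\<^sup>2 \<phi>\<close> vanishes there
  and \<open>F_(m+2) = (x + y) F_m\<close>; it remains to compute \<open>F_0\<close> and \<open>F_1\<close>.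
\<close>

section \<open>Partitions as row-length functions\<close>

text \<open>Rows are indexed from 0 here, while cells keep 1-based coordinates: row \<open>r\<close> consists of
  the cells \<open>(Suc r, j)\<close> with \<open>1 \<le> j \<le> l r\<close>.\<close>

definition young :: "(nat \<Rightarrow> nat) \<Rightarrow> bool" where
  "young l \<longleftrightarrow> antimono l \<and> (\<exists>n. l n = 0)"

definition cells :: "(nat \<Rightarrow> nat) \<Rightarrow> (nat \<times> nat) set" where
  "cells l = {(i, j). 1 \<le> i \<and> 1 \<le> j \<and> j \<le> l (i - 1)}"

definition inc :: "(nat \<Rightarrow> nat) \<Rightarrow> nat \<Rightarrow> nat \<Rightarrow> nat" where
  "inc l r = l(r := Suc (l r))"

definition dec :: "(nat \<Rightarrow> nat) \<Rightarrow> nat \<Rightarrow> nat \<Rightarrow> nat" where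
  "dec l r = l(r := l r - 1)"

definition addable :: "(nat \<Rightarrow> nat) \<Rightarrow> nat set" where
  "addable l = {r. r = 0 \<or> l r < l (r - 1)}"

definition removable :: "(nat \<Rightarrow> nat) \<Rightarrow> nat set" where
  "removable l = {r. l (Suc r) < l r}"

text \<open>A largest entry at the end of row \<open>r\<close> is inverted with the cells that
  follow it in reading order, which are those of the lower rows; hence this is the sign exponent of
  both operators.\<close>

definition below :: "(nat \<Rightarrow> nat) \<Rightarrow> nat \<Rightarrow> nat" where
  "below l r = card {(i, j) \<in> cells l. Suc r < i}"

lemma youngD: "young l \<Longrightarrow> i \<le> j \<Longrightarrow> l j \<le> l i"
  by (auto simp: young_def dest: antimonoD)

lemma young_Suc: "young l \<Longrightarrow> l (Suc i) \<le> l i"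
  by (rule youngD) auto

lemma young_pred: "young l \<Longrightarrow> l i \<le> l (i - 1)"
  by (rule youngD) auto

lemma youngI: "(\<And>i. l (Suc i) \<le> l i) \<Longrightarrow> l n = 0 \<Longrightarrow> young l"
  by (auto simp: young_def antimono_def intro: lift_Suc_antimono_le)

lemma young_zero:
  assumes "young l"
  obtains n where "\<And>i. n \<le> i \<Longrightarrow> l i = 0"
  using assms youngD[OF assms] unfolding young_def by (metis le_zero_eq)

lemma finite_cells: assumes "young l" shows "finite (cells l)"
proof -
  obtain n where n: "\<And>i. n \<le> i \<Longrightarrow> l i = 0" using young_zero[OF assms] by blast
  have "cells l \<subseteq> {..n} \<times> {..l 0}"
  proof (clarsimp simp: cells_def)
    fix i j assume *: "Suc 0 \<le> i" "Suc 0 \<le> j" "j \<le> l (i - Suc 0)"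
    show "i \<le> n \<and> j \<le> l 0"
      using * n[of "i - 1"] youngD[OF assms, of 0 "i - 1"] by (cases "n \<le> i - 1") auto
  qed
  then show ?thesis by (rule finite_subset) auto
qed

lemma young_inc:
  assumes l: "young l" and r: "r \<in> addable l" shows "young (inc l r)"
proof -
  obtain n where n: "\<And>i. n \<le> i \<Longrightarrow> l i = 0" using young_zero[OF l] by blast
  have "inc l r (Suc i) \<le> inc l r i" for i
    using r young_Suc[OF l, of i] by (auto simp: inc_def addable_def)
  moreover have "inc l r (n + Suc r) = 0" by (simp add: inc_def n)
  ultimately show ?thesis by (rule youngI)
qed

lemma young_dec:
  assumes l: "young l" and r: "r \<in> removable l" shows "young (dec l r)"
proof -
  obtain n where n: "\<And>i. n \<le> i \<Longrightarrow> l i = 0" using young_zero[OF l] by blast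
  have "dec l r (Suc i) \<le> dec l r i" for i
    using r young_Suc[OF l, of i] by (auto simp: dec_def removable_def)
  moreover have "dec l r n = 0" by (simp add: dec_def n)
  ultimately show ?thesis by (rule youngI)
qed

lemma addable_bound:
  assumes "\<And>i. n \<le> i \<Longrightarrow> l i = 0" shows "addable l \<subseteq> {..n}"
proof
  fix r assume "r \<in> addable l"
  then show "r \<in> {..n}" using assms[of "r - 1"] by (cases "n \<le> r - 1") (auto simp: addable_def)
qed

lemma removable_bound:
  assumes "\<And>i. n \<le> i \<Longrightarrow> l i = 0" shows "removable l \<subseteq> {..<n}"
proof
  fix r assume "r \<in> removable l"
  then show "r \<in> {..<n}" using assms[of r] by (cases "r < n") (auto simp: removable_def)
qed

lemma finite_addable: "young l \<Longrightarrow> finite (addable l)"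
  by (metis young_zero addable_bound finite_atMost finite_subset)

lemma finite_removable: "young l \<Longrightarrow> finite (removable l)"
  by (metis young_zero removable_bound finite_lessThan finite_subset)

lemma cells_inc: "cells (inc l r) = insert (Suc r, Suc (l r)) (cells l)"
  by (auto simp: cells_def inc_def split: if_splits)

lemma inc_dec: "0 < l r \<Longrightarrow> inc (dec l r) r = l"
  by (auto simp: inc_def dec_def)

lemma dec_inc: "dec (inc l r) r = l"
  by (auto simp: inc_def dec_def)

lemma inc_same: "inc l r r = Suc (l r)"
  by (simp add: inc_def)

lemma dec_same: "dec l r r = l r - 1"
  by (simp add: dec_def)

lemma removable_pos: "r \<in> removable l \<Longrightarrow> 0 < l r"
  by (auto simp: removable_def)

lemma removable_inc: "young l \<Longrightarrow> r \<in> removable (inc l r)"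
  using young_Suc[of l r] by (auto simp: removable_def inc_def)

lemma addable_dec: "young l \<Longrightarrow> r \<in> removable l \<Longrightarrow> r \<in> addable (dec l r)"
  using young_pred[of l r] by (auto simp: removable_def addable_def dec_def)

text \<open>The two operations interfere only if \<open>s = r - 1\<close>, and then each side
  requires row \<open>s\<close> to exceed row \<open>r\<close> by at least 2.\<close>

lemma addable_removable_swap:
  assumes "young l" "r \<noteq> s"
  shows "r \<in> addable l \<and> s \<in> removable (inc l r) \<longleftrightarrow> s \<in> removable l \<and> r \<in> addable (dec l s)"
  using assms young_Suc[of l s]
  by (auto simp: addable_def removable_def inc_def dec_def split: if_splits)

lemma dec_inc_swap: "r \<noteq> s \<Longrightarrow> dec (inc l r) s = inc (dec l s) r"
  by (auto simp: inc_def dec_def)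

lemma below_inc:
  assumes "young l" shows "below (inc l r) s = below l s + (if s < r then 1 else 0)"
proof -
  have "finite {(i, j) \<in> cells l. Suc s < i}"
    using finite_cells[OF assms] by (rule rev_finite_subset) auto
  moreover have "{(i, j) \<in> cells (inc l r). Suc s < i} =
     (if s < r then insert (Suc r, Suc (l r)) {(i, j) \<in> cells l. Suc s < i}
      else {(i, j) \<in> cells l. Suc s < i})"
    by (auto simp: cells_inc)
  moreover have "(Suc r, Suc (l r)) \<notin> cells l" by (auto simp: cells_def)
  ultimately show ?thesis by (auto simp: below_def)
qed

lemma below_dec:
  assumes "young l" "r \<in> removable l"
  shows "below l s = below (dec l r) s + (if s < r then 1 else 0)"
  using below_inc[OF young_dec[OF assms], of r s] removable_pos[OF assms(2)] by (simp add: inc_dec)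

lemma below_Suc:
  assumes "young l" shows "below l r = l (Suc r) + below l (Suc r)"
proof -
  let ?A = "Pair (Suc (Suc r)) ` {1..l (Suc r)}" and ?B = "{(i, j) \<in> cells l. Suc (Suc r) < i}"
  have "{(i, j) \<in> cells l. Suc r < i} = ?A \<union> ?B"
    by (auto simp: cells_def image_iff not_less le_Suc_eq)
  moreover have "finite ?B"
    using finite_cells[OF assms] by (rule rev_finite_subset) auto
  moreover have "?A \<inter> ?B = {}" by auto
  moreover have "card ?A = l (Suc r)" by (subst card_image) (auto simp: inj_on_def)
  ultimately show ?thesis by (simp add: below_def card_Un_disjoint)
qed

text \<open>Separates the pairs within one row from those in two rows and groups the two orders of
  each of the latter, whose signs cancel.\<close>

lemma sum_double_split:
  fixes g :: "nat \<Rightarrow> nat \<Rightarrow> 'a::comm_ring_1"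
  shows "(\<Sum>r<n. \<Sum>s<n. g r s) = (\<Sum>r<n. g r r + (\<Sum>s<r. g r s + g s r))"
  by (induction n) (simp_all add: sum.distrib algebra_simps)

lemma sum_if_mem:
  fixes f :: "nat \<Rightarrow> 'a::comm_ring_1"
  assumes "S \<subseteq> {..<n}" shows "sum f S = (\<Sum>r<n. if r \<in> S then f r else 0)"
  using assms by (simp add: sum.If_cases Int_absorb1)

lemma sum_sum_if_mem:
  fixes c :: "nat \<Rightarrow> 'a::comm_ring_1"
  assumes A: "A \<subseteq> {..<n}" and B: "\<And>r. r \<in> A \<Longrightarrow> B r \<subseteq> {..<n}"
  shows "(\<Sum>r\<in>A. c r * (\<Sum>s\<in>B r. d r s * e r s)) =
    (\<Sum>r<n. \<Sum>s<n. if r \<in> A \<and> s \<in> B r then c r * d r s * e r s else 0)"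
  unfolding sum_if_mem[OF A]
proof (rule sum.cong[OF refl])
  fix r
  show "(if r \<in> A then c r * (\<Sum>s\<in>B r. d r s * e r s) else 0) =
      (\<Sum>s<n. if r \<in> A \<and> s \<in> B r then c r * d r s * e r s else 0)"
    using sum_if_mem[OF B, of r "\<lambda>s. c r * d r s * e r s"]
    by (simp add: sum_distrib_left mult.assoc)
qed

section \<open>Signed operators adding and removing cells\<close>

context
  fixes x y z :: "'a::comm_ring_1"
begin

definition wt :: "nat \<Rightarrow> nat \<Rightarrow> 'a" where
  "wt i j = (if even i then x else 1) * (if even j then y else 1) * (if even i \<and> even j then z else 1)"

text \<open>Chosen such that the diagonal of \<open>UD + DU\<close> telescopes and the domino weights of \<open>D\<^sup>2\<close>
  are those of \<open>U\<^sup>2\<close> shifted by one row or column.\<close>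

definition cowt :: "nat \<Rightarrow> nat \<Rightarrow> 'a" where
  "cowt i j = (if even i then (if even j then 1 else y) else (if even j then - x else - (x * y * z)))"

definition up_coeff :: "(nat \<Rightarrow> nat) \<Rightarrow> nat \<Rightarrow> 'a" where
  "up_coeff l r = (-1) ^ below l r * wt (Suc r) (Suc (l r))"

definition down_coeff :: "(nat \<Rightarrow> nat) \<Rightarrow> nat \<Rightarrow> 'a" where
  "down_coeff l r = (-1) ^ below l r * cowt (Suc r) (l r)"

definition up :: "((nat \<Rightarrow> nat) \<Rightarrow> 'a) \<Rightarrow> (nat \<Rightarrow> nat) \<Rightarrow> 'a" where
  "up \<phi> l = (\<Sum>r\<in>addable l. up_coeff l r * \<phi> (inc l r))"

definition down :: "((nat \<Rightarrow> nat) \<Rightarrow> 'a) \<Rightarrow> (nat \<Rightarrow> nat) \<Rightarrow> 'a" where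
  "down \<phi> l = (\<Sum>r\<in>removable l. down_coeff l r * \<phi> (dec l r))"

text \<open>The operator relations hold only at Young functions. Since adding or removing a corner
  stays among these, the relations may be applied under an operator.\<close>

lemma up_cong: "young l \<Longrightarrow> (\<And>m. young m \<Longrightarrow> \<phi> m = \<psi> m) \<Longrightarrow> up \<phi> l = up \<psi> l"
  by (auto simp: up_def young_inc intro!: sum.cong)

lemma down_cong: "young l \<Longrightarrow> (\<And>m. young m \<Longrightarrow> \<phi> m = \<psi> m) \<Longrightarrow> down \<phi> l = down \<psi> l"
  by (auto simp: down_def young_dec intro!: sum.cong)

lemma up_linear: "up (\<lambda>m. \<phi> m + c * \<psi> m) l = up \<phi> l + c * up \<psi> l"
  by (simp add: up_def sum.distrib sum_distrib_left algebra_simps)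

lemma down_linear: "down (\<lambda>m. c * \<phi> m - \<psi> m) l = c * down \<phi> l - down \<psi> l"
  by (simp add: down_def sum_subtractf sum_distrib_left algebra_simps)

section \<open>The anticommutation relation\<close>

lemma diagonal_sum:
  assumes l: "young l"
  shows "(\<Sum>r\<in>addable l. wt (Suc r) (Suc (l r)) * cowt (Suc r) (Suc (l r))) +
    (\<Sum>r\<in>removable l. wt (Suc r) (l r) * cowt (Suc r) (l r)) = - (x * y * z)"
proof -
  define p where "p i j = wt i j * cowt i j" for i j
  \<comment> \<open>\<open>p i j\<close> is \<open>g j\<close> for even \<open>i\<close> and
    \<open>- g (Suc j)\<close> for odd \<open>i\<close>. As \<open>g j + g (Suc j)\<close> is
    constant, an addable corner and the removable corner one row above it contribute a difference of
    values of \<open>g\<close>.\<close>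
  define g where "g j = (if even j then x * y * z else x * y)" for j :: nat
  obtain n where n: "\<And>i. n \<le> i \<Longrightarrow> l i = 0" using young_zero[OF l] by blast
  have rows: "p (Suc i) (Suc a) + p i b = g (Suc a) - g (Suc b)" for i a b
    by (auto simp: p_def g_def wt_def cowt_def algebra_simps)
  have "(\<Sum>r\<in>addable l. p (Suc r) (Suc (l r))) =
      (\<Sum>r<Suc n. if r \<in> addable l then p (Suc r) (Suc (l r)) else 0)"
    using addable_bound[of n l] n by (intro sum_if_mem) auto
  \<comment> \<open>Row \<open>Suc r\<close> has an addable corner exactly when row \<open>r\<close>
    has a removable one, so only the addable corner of the top row stays unpaired.\<close>
  also have "\<dots> = p 1 (Suc (l 0)) +
      (\<Sum>r<n. if l (Suc r) < l r then p (Suc (Suc r)) (Suc (l (Suc r))) else 0)"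
    by (subst sum.lessThan_Suc_shift) (auto simp: addable_def cong: sum.cong)
  finally have "(\<Sum>r\<in>addable l. p (Suc r) (Suc (l r))) + (\<Sum>r\<in>removable l. p (Suc r) (l r)) =
      p 1 (Suc (l 0)) + (\<Sum>r<n. if l (Suc r) < l r
         then p (Suc (Suc r)) (Suc (l (Suc r))) + p (Suc r) (l r) else 0)"
    using removable_bound[of n l] n
    by (subst sum_if_mem[of "removable l" n])
       (auto simp: removable_def sum.distrib[symmetric] add.assoc intro!: sum.cong)
  \<comment> \<open>For rows of equal length the difference is 0, so the sum telescopes over all
    rows.\<close>
  also have "(\<Sum>r<n. if l (Suc r) < l r
         then p (Suc (Suc r)) (Suc (l (Suc r))) + p (Suc r) (l r) else 0) =
      (\<Sum>r<n. g (Suc (l (Suc r))) - g (Suc (l r)))"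
    by (intro sum.cong) (auto simp: rows not_less dest: le_antisym[OF young_Suc[OF l]])
  also have "\<dots> = g (Suc (l n)) - g (Suc (l 0))"
    by (rule sum_lessThan_telescope)
  also have "p 1 (Suc (l 0)) + (g (Suc (l n)) - g (Suc (l 0))) = - (x * y * z)"
    by (auto simp: p_def g_def wt_def cowt_def n)
  finally show ?thesis by (simp add: p_def)
qed

text \<open>The cell in the lower row counts in \<open>below\<close> for the upper row only, so
  exchanging the two operations flips exactly one sign. The weights depend only on the cell's own
  row and do not change.\<close>

lemma coeff_swap:
  assumes l: "young l" and rs: "r \<noteq> s" and r: "r \<in> addable l" and s: "s \<in> removable l"
  shows "up_coeff l r * down_coeff (inc l r) s + down_coeff l s * up_coeff (dec l s) r = 0"
proof -
  have "below (inc l r) s = below l s + (if s < r then 1 else 0)"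
    "below l r = below (dec l s) r + (if r < s then 1 else 0)"
    using below_inc[OF l] below_dec[OF l s] by auto
  then show ?thesis using rs
    by (auto simp: up_coeff_def down_coeff_def inc_def dec_def algebra_simps nat_neq_iff)
qed

lemma up_down_anticommute:
  assumes l: "young l"
  shows "up (down \<phi>) l + down (up \<phi>) l = - (x * y * z) * \<phi> l"
proof -
  let ?A = "SIGMA r:addable l. removable (inc l r)"
  let ?B = "SIGMA s:removable l. addable (dec l s)"
  let ?f = "\<lambda>(r, s). up_coeff l r * down_coeff (inc l r) s * \<phi> (dec (inc l r) s)"
  let ?g = "\<lambda>(s, r). down_coeff l s * up_coeff (dec l s) r * \<phi> (inc (dec l s) r)"
  have fin: "finite ?A" "finite ?B"
    using l by (auto intro!: finite_SigmaI finite_addable finite_removable young_inc young_dec)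
  have "up (down \<phi>) l = sum ?f ?A"
    unfolding up_def down_def using l
    by (subst sum.Sigma[symmetric])
       (auto simp: finite_addable finite_removable young_inc sum_distrib_left mult.assoc)
  also have "\<dots> = sum ?f {p\<in>?A. fst p = snd p} + sum ?f {p\<in>?A. fst p \<noteq> snd p}"
    using fin by (subst sum.union_disjoint[symmetric]) (auto intro!: sum.cong)
  \<comment> \<open>Here the added cell is removed again. \<open>below\<close> ignores the row
    itself, so both signs agree and multiply to 1.\<close>
  also have "sum ?f {p\<in>?A. fst p = snd p} =
      (\<Sum>r\<in>addable l. wt (Suc r) (Suc (l r)) * cowt (Suc r) (Suc (l r)) * \<phi> l)"
    using l by (intro sum.reindex_bij_witness[of _ "\<lambda>r. (r, r)" fst])
      (auto simp: removable_inc dec_inc up_coeff_def down_coeff_def below_inc inc_same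
        algebra_simps minus_one_power_iff)
  finally have up: "up (down \<phi>) l = \<dots> + sum ?f {p\<in>?A. fst p \<noteq> snd p}" .
  have "down (up \<phi>) l = sum ?g ?B"
    unfolding up_def down_def using l
    by (subst sum.Sigma[symmetric])
       (auto simp: finite_addable finite_removable young_dec sum_distrib_left mult.assoc)
  also have "\<dots> = sum ?g {p\<in>?B. fst p = snd p} + sum ?g {p\<in>?B. fst p \<noteq> snd p}"
    using fin by (subst sum.union_disjoint[symmetric]) (auto intro!: sum.cong)
  also have "sum ?g {p\<in>?B. fst p = snd p} =
      (\<Sum>r\<in>removable l. wt (Suc r) (l r) * cowt (Suc r) (l r) * \<phi> l)"
    using l by (intro sum.reindex_bij_witness[of _ "\<lambda>r. (r, r)" fst])
      (auto simp: addable_dec inc_dec removable_pos up_coeff_def down_coeff_def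
        below_dec[of l r r for r] dec_same algebra_simps minus_one_power_iff)
  finally have down: "down (up \<phi>) l = \<dots> + sum ?g {p\<in>?B. fst p \<noteq> snd p}" .
  \<comment> \<open>The other pairs correspond under exchange of the operations and have opposite
    coefficients.\<close>
  have "sum ?g {p\<in>?B. fst p \<noteq> snd p} = sum (\<lambda>p. - ?f p) {p\<in>?A. fst p \<noteq> snd p}"
  proof (intro sum.reindex_bij_witness[of _ prod.swap prod.swap])
    fix p assume p: "p \<in> {p\<in>?B. fst p \<noteq> snd p}"
    obtain s r where [simp]: "p = (s, r)" by (cases p)
    have *: "r \<noteq> s" "s \<in> removable l" "r \<in> addable l" "s \<in> removable (inc l r)"
      using p addable_removable_swap[OF l, of r s] by auto
    show "prod.swap p \<in> {p\<in>?A. fst p \<noteq> snd p}" using * by auto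
    show "- ?f (prod.swap p) = ?g p"
      using coeff_swap[OF l *(1,3,2)] * unfolding add_eq_0_iff
      by (simp add: dec_inc_swap)
  next
    fix p assume p: "p \<in> {p\<in>?A. fst p \<noteq> snd p}"
    then show "prod.swap p \<in> {p\<in>?B. fst p \<noteq> snd p}"
      using addable_removable_swap[OF l, of "fst p" "snd p"] by auto
  qed auto
  with up down diagonal_sum[OF l] show ?thesis
    by (simp add: sum_negf sum_distrib_right[symmetric] distrib_right[symmetric])
qed

text \<open>With \<open>c = - (x * y * z)\<close>, using \<open>DU = c - UD\<close> twice gives
  \<open>DDU = cD - DUD = cD - (cD - UDD) = UDD\<close>.\<close>

lemma down2_up:
  assumes l: "young l"
  shows "down (down (up \<phi>)) l = up (down (down \<phi>)) l"
proof -
  let ?c = "- (x * y * z)"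
  have *: "down (up \<psi>) m = ?c * \<psi> m - up (down \<psi>) m" if "young m" for \<psi> m
    using up_down_anticommute[OF that, of \<psi>] by (simp add: algebra_simps)
  have "down (down (up \<phi>)) l = down (\<lambda>m. ?c * \<phi> m - up (down \<phi>) m) l"
    by (rule down_cong[OF l]) (rule *)
  also have "\<dots> = ?c * down \<phi> l - down (up (down \<phi>)) l"
    by (rule down_linear)
  finally show ?thesis using *[OF l, of "down \<phi>"] by simp
qed

lemma down2_up_power:
  "young l \<Longrightarrow> down (down ((up ^^ m) \<phi>)) l = (up ^^ m) (down (down \<phi>)) l"
  by (induction m arbitrary: l) (auto simp: down2_up intro: up_cong)

section \<open>Squares of the operators as sums over dominoes\<close>

lemma up2_expand:
  assumes l: "young l" and n: "\<forall>i\<ge>n. l i = 0"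
  shows "up (up \<phi>) l = (\<Sum>r<n+2. \<Sum>s<n+2. if r \<in> addable l \<and> s \<in> addable (inc l r)
    then up_coeff l r * up_coeff (inc l r) s * \<phi> (inc (inc l r) s) else 0)"
proof -
  \<comment> \<open>Two added cells reach row \<open>n + 1\<close> at most. Removal is expanded over
    the same range, so that both double sums can be compared row by row.\<close>
  have "addable l \<subseteq> {..<n+2}" using addable_bound[of n l] n by auto
  moreover have "addable (inc l r) \<subseteq> {..<n+2}" if "r \<in> addable l" for r
    using addable_bound[of "Suc n" "inc l r"] addable_bound[of n l] n that
    by (fastforce simp: inc_def)
  ultimately show ?thesis
    unfolding up_def by (rule sum_sum_if_mem)
qed

lemma down2_expand:
  assumes l: "young l" and n: "\<forall>i\<ge>n. l i = 0"
  shows "down (down \<phi>) l = (\<Sum>r<n+2. \<Sum>s<n+2. if r \<in> removable l \<and> s \<in> removable (dec l r)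
    then down_coeff l r * down_coeff (dec l r) s * \<phi> (dec (dec l r) s) else 0)"
proof -
  have "removable l \<subseteq> {..<n+2}" using removable_bound[of n l] n by auto
  moreover have "removable (dec l r) \<subseteq> {..<n+2}" if "r \<in> removable l" for r
    using removable_bound[of n "dec l r"] n that by (fastforce simp: dec_def)
  ultimately show ?thesis
    unfolding down_def by (rule sum_sum_if_mem)
qed

text \<open>Signed weights in \<open>U\<^sup>2\<close> of a horizontal domino in row \<open>r\<close> (0-based) and of a vertical
  domino in column \<open>Suc j\<close> (1-based).\<close>

definition hdomino :: "nat \<Rightarrow> 'a" where
  "hdomino r = (if even r then y else x * x * y * z)"

definition vdomino :: "nat \<Rightarrow> 'a" where
  "vdomino j = (if even j then x else - (x * y * y * z))"

lemma up2_same: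
  assumes l: "young l"
  shows "(if r \<in> addable l \<and> r \<in> addable (inc l r) then up_coeff l r * up_coeff (inc l r) r else 0)
    = (if r = 0 \<or> l r + 2 \<le> l (r - 1) then hdomino r else 0)"
proof -
  have "up_coeff l r * up_coeff (inc l r) r = hdomino r"
    by (auto simp: up_coeff_def below_inc[OF l] inc_same wt_def hdomino_def algebra_simps minus_one_power_iff)
  moreover have "r \<in> addable l \<and> r \<in> addable (inc l r) \<longleftrightarrow> r = 0 \<or> l r + 2 \<le> l (r - 1)"
    by (auto simp: addable_def inc_def)
  ultimately show ?thesis by simp
qed

text \<open>The complementary weights are chosen for this shift: removing a horizontal domino from
  row \<open>r\<close> has the condition and the weight of adding one to row
  \<open>Suc r\<close>.\<close>

lemma down2_same:
  assumes l: "young l"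
  shows "(if r \<in> removable l \<and> r \<in> removable (dec l r) then down_coeff l r * down_coeff (dec l r) r else 0)
    = (if l (Suc r) + 2 \<le> l r then hdomino (Suc r) else 0)"
proof -
  have "down_coeff l r * down_coeff (dec l r) r = hdomino (Suc r)" if "r \<in> removable l" "2 \<le> l r"
    using that below_dec[OF l that(1), of r]
    by (auto simp: down_coeff_def dec_same cowt_def hdomino_def algebra_simps minus_one_power_iff)
  moreover have "r \<in> removable l \<and> r \<in> removable (dec l r) \<longleftrightarrow> l (Suc r) + 2 \<le> l r"
    by (auto simp: removable_def dec_def)
  ultimately show ?thesis by auto
qed

text \<open>Adding two cells in different rows in either order gives opposite signs, so only the
  pairs that can be added in just one order survive: these are vertical dominoes.\<close>

lemma up2_cross:
  assumes l: "young l" and sr: "s < r"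
  shows "(if r \<in> addable l \<and> s \<in> addable (inc l r) then up_coeff l r * up_coeff (inc l r) s else 0) +
     (if s \<in> addable l \<and> r \<in> addable (inc l s) then up_coeff l s * up_coeff (inc l s) r else 0)
    = (if r = Suc s \<and> l s = l r \<and> s \<in> addable l then vdomino (l s) else 0)"
proof -
  have b: "below (inc l r) s = Suc (below l s)" "below (inc l s) r = below l r"
    using sr by (auto simp: below_inc[OF l])
  have e: "inc l r s = l s" "inc l s r = l r" using sr by (auto simp: inc_def)
  have 1: "r \<in> addable l \<and> s \<in> addable (inc l r) \<longleftrightarrow> r \<in> addable l \<and> s \<in> addable l"
    using sr by (auto simp: addable_def inc_def split: if_splits)
  have 2: "s \<in> addable l \<and> r \<in> addable (inc l s) \<longleftrightarrow>
      s \<in> addable l \<and> (r \<in> addable l \<or> (r = Suc s \<and> l s = l r))"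
    using sr young_pred[OF l, of r] by (auto simp: addable_def inc_def split: if_splits)
  have 3: "\<not> (r \<in> addable l \<and> (r = Suc s \<and> l s = l r))"
    by (auto simp: addable_def)
  have 4: "up_coeff l r * up_coeff (inc l r) s + up_coeff l s * up_coeff (inc l s) r = 0"
    by (simp add: up_coeff_def b e algebra_simps)
  \<comment> \<open>Row \<open>r\<close> itself lies below row \<open>s\<close>, so the two sign
    exponents differ by \<open>l r\<close>; this is the sign in \<open>vdomino\<close>.\<close>
  have 5: "up_coeff l s * up_coeff (inc l s) r = vdomino (l s)" if "r = Suc s" "l s = l r"
    unfolding up_coeff_def b e using that
    by (auto simp: below_Suc[OF l, of s] wt_def vdomino_def algebra_simps minus_one_power_iff)
  show ?thesis unfolding 1 2 using 3 4 5 by auto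
qed

text \<open>Removing the lower cell first lowers the exponent of the upper row by one; removing the
  upper cell first changes no exponent of the lower row.\<close>

lemma down2_cross_coeff:
  assumes l: "young l" and sr: "s < r" and "r \<in> removable l" "s \<in> removable l"
  shows "down_coeff l r * down_coeff (dec l r) s + down_coeff l s * down_coeff (dec l s) r = 0"
proof -
  have "below l s = Suc (below (dec l r) s)" "below (dec l s) r = below l r"
    using sr below_dec[OF l, of r s] below_dec[OF l, of s r] assms by auto
  moreover have e: "dec l r s = l s" "dec l s r = l r" using sr by (auto simp: dec_def)
  ultimately show ?thesis by (simp add: down_coeff_def algebra_simps)
qed

text \<open>Mirror image of addition: a pair removable in one order only is a vertical domino whose
  lower cell goes first. It lies in column \<open>l s\<close>, but its weight is that of adding a
  domino in the next column.\<close>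

lemma down2_cross:
  assumes l: "young l" and sr: "s < r"
  shows "(if r \<in> removable l \<and> s \<in> removable (dec l r) then down_coeff l r * down_coeff (dec l r) s else 0) +
     (if s \<in> removable l \<and> r \<in> removable (dec l s) then down_coeff l s * down_coeff (dec l s) r else 0)
    = (if r = Suc s \<and> l s = l r \<and> r \<in> removable l then vdomino (l s) else 0)"
proof -
  have 1: "s \<in> removable l \<and> r \<in> removable (dec l s) \<longleftrightarrow> r \<in> removable l \<and> s \<in> removable l"
    using sr by (auto simp: removable_def dec_def split: if_splits)
  have 2: "r \<in> removable l \<and> s \<in> removable (dec l r) \<longleftrightarrow>
      r \<in> removable l \<and> (s \<in> removable l \<or> (r = Suc s \<and> l s = l r))"
    using sr young_pred[OF l, of r] by (auto simp: removable_def dec_def split: if_splits)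
  have 3: "\<not> (s \<in> removable l \<and> (r = Suc s \<and> l s = l r))"
    by (auto simp: removable_def)
  have 5: "down_coeff l r * down_coeff (dec l r) s = vdomino (l s)"
    if "r = Suc s" "l s = l r" and r: "r \<in> removable l"
  proof -
    have "below l s = Suc (below (dec l r) s)" "dec l r s = l s"
      using sr below_dec[OF l r, of s] by (auto simp: dec_def)
    moreover have "below l s = l r + below l r" using below_Suc[OF l, of s] that by simp
    \<comment> \<open>The lower cell is already gone, which costs one in the exponent. This extra
      sign is compensated by the minus sign of \<open>cowt\<close> in the odd one of the two
      rows.\<close>
    ultimately have "even (below (dec l r) s) \<longleftrightarrow> even (l r) \<noteq> even (below l r)"
      and "dec l r s = l r" using that by (metis even_Suc even_add, simp)
    then show ?thesis using that
      by (auto simp: down_coeff_def cowt_def vdomino_def algebra_simps minus_one_power_iff)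
  qed
  show ?thesis unfolding 1 2 using 3 down2_cross_coeff[OF l sr] 5 by auto
qed

lemma sum_pred_only:
  fixes f :: "nat \<Rightarrow> 'b::comm_ring_1"
  shows "(\<Sum>s<r. if r = Suc s \<and> P s then f s else 0) = (if 0 < r \<and> P (r - 1) then f (r - 1) else 0)"
proof (cases r)
  case (Suc m)
  have "(\<Sum>s<r. if r = Suc s \<and> P s then f s else 0) = (\<Sum>s<r. if s = m then (if P m then f m else 0) else 0)"
    by (rule sum.cong) (auto simp: Suc)
  then show ?thesis by (simp add: Suc sum.delta)
qed simp

lemma up2_minus_down2_one:
  assumes l: "young l"
  shows "up (up (\<lambda>_. 1)) l = down (down (\<lambda>_. 1)) l + (x + y)"
proof -
  obtain n where n: "\<And>i. n \<le> i \<Longrightarrow> l i = 0" using young_zero[OF l] by blast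
  then have n': "\<forall>i\<ge>n. l i = 0" by blast
  \<comment> \<open>\<open>e\<close> records equal rows \<open>r\<close> and \<open>Suc r\<close>,
    and \<open>t\<close> three equal rows centred at \<open>r\<close>. A vertical domino can be
    added to an equal pair unless the row above is equal too, and removed unless the row below is,
    which gives \<open>e r - t r\<close> and \<open>e r - t (Suc r)\<close>.\<close>
  define t where "t r = (if 0 < r \<and> l (r - 1) = l r \<and> l r = l (Suc r) then vdomino (l r) else 0)" for r
  define e where "e r = (if l r = l (Suc r) then vdomino (l r) else 0)" for r
  define h where "h r = (if l (Suc r) + 2 \<le> l r then hdomino (Suc r) else 0)" for r
  have et1: "(if l r = l (Suc r) \<and> r \<in> addable l then vdomino (l r) else 0) = e r - t r" for r
    using young_pred[OF l, of r] by (auto simp: e_def t_def addable_def)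
  have et2: "(if l r = l (Suc r) \<and> Suc r \<in> removable l then vdomino (l r) else 0) = e r - t (Suc r)" for r
    using young_Suc[OF l, of "Suc r"] by (auto simp: e_def t_def removable_def)
  have "up (up (\<lambda>_. 1)) l = (\<Sum>r<n+2. (if r = 0 \<or> l r + 2 \<le> l (r - 1) then hdomino r else 0) +
      (if 0 < r \<and> l (r - 1) = l r \<and> r - 1 \<in> addable l then vdomino (l (r - 1)) else 0))"
    unfolding up2_expand[OF l n'] mult_1_right sum_double_split up2_same[OF l]
    by (intro sum.cong refl arg_cong2[where f="(+)"]
        trans[OF sum.cong[OF refl up2_cross[OF l]] sum_pred_only]) simp
  \<comment> \<open>The horizontal domino in row 0 gives \<open>y\<close>; those in row
    \<open>Suc r\<close> match the dominoes removed from row \<open>r\<close>.\<close>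
  also have "\<dots> = y + (\<Sum>r<Suc n. h r + (e r - t r))"
    unfolding add_2_eq_Suc' sum.lessThan_Suc_shift[of _ "Suc n"] diff_Suc_1 et1[symmetric]
    by (simp add: h_def hdomino_def del: sum.lessThan_Suc)
  also have "\<dots> = y + (\<Sum>r<Suc n. h r + (e r - t (Suc r))) + (\<Sum>r<Suc n. t (Suc r) - t r)"
    by (simp add: sum.distrib sum_subtractf del: sum.lessThan_Suc)
  \<comment> \<open>The upper end \<open>t (Suc n)\<close> sees three empty rows and is
    \<open>vdomino 0 = x\<close>, while \<open>t 0\<close> is 0.\<close>
  also have "(\<Sum>r<Suc n. t (Suc r) - t r) = x"
    unfolding sum_lessThan_telescope by (simp add: t_def n vdomino_def)
  also have "(\<Sum>r<Suc n. h r + (e r - t (Suc r))) = (\<Sum>r<n+2. h r +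
      (if 0 < r \<and> l (r - 1) = l r \<and> r \<in> removable l then vdomino (l (r - 1)) else 0))"
    (is "_ = (\<Sum>r<n+2. h r + ?q r)")
  proof -
    have "(\<Sum>r<n+2. h r + ?q r) = (\<Sum>r<n+2. h r) + (\<Sum>r<n+2. ?q r)"
      by (rule sum.distrib)
    also have "(\<Sum>r<n+2. h r) = (\<Sum>r<Suc n. h r)" by (simp add: h_def n)
    also have "(\<Sum>r<n+2. ?q r) = (\<Sum>r<Suc n. e r - t (Suc r))"
      unfolding add_2_eq_Suc' sum.lessThan_Suc_shift[of _ "Suc n"] diff_Suc_1 et2[symmetric]
      by (simp del: sum.lessThan_Suc)
    finally show ?thesis by (simp add: sum.distrib)
  qed
  also have "\<dots> = down (down (\<lambda>_. 1)) l"
    unfolding down2_expand[OF l n'] mult_1_right sum_double_split down2_same[OF l] h_def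
    by (intro sum.cong refl arg_cong2[where f="(+)"]
        trans[OF sum.cong[OF refl down2_cross[OF l]] sum_pred_only, symmetric]) simp
  finally show ?thesis by (simp add: algebra_simps)
qed

section \<open>Evaluation at staircases\<close>

lemma young_staircase: "young (\<lambda>i. k - i)"
  by (rule youngI[of _ k]) auto

lemma down2_staircase: "down (down \<phi>) (\<lambda>i. k - i) = 0"
proof -
  let ?l = "\<lambda>i. k - i"
  have rem: "r \<in> removable ?l \<longleftrightarrow> r < k" for r by (auto simp: removable_def)
  \<comment> \<open>Removing a cell from row \<open>r\<close> makes it as long as the next row, so
    row \<open>r\<close> is blocked and all other corners stay. Hence only pairs in two rows occur,
    each in both orders, and they cancel.\<close>
  have rem2: "s \<in> removable (dec ?l r) \<longleftrightarrow> s < k \<and> s \<noteq> r" if "r < k" for r s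
    using that by (auto simp: removable_def dec_def)
  have comm: "dec (dec ?l r) s = dec (dec ?l s) r" for r s
    by (auto simp: dec_def)
  have *: "down_coeff ?l r * down_coeff (dec ?l r) s * \<phi> (dec (dec ?l r) s) +
      down_coeff ?l s * down_coeff (dec ?l s) r * \<phi> (dec (dec ?l s) r) = 0" if "s < r" "r < k" for r s
    using down2_cross_coeff[OF young_staircase[of k] \<open>s < r\<close>] that
    by (simp add: rem comm[of r s] distrib_right[symmetric])
  have "down (down \<phi>) ?l = (\<Sum>r<k+2. \<Sum>s<k+2. if r \<in> removable ?l \<and> s \<in> removable (dec ?l r)
      then down_coeff ?l r * down_coeff (dec ?l r) s * \<phi> (dec (dec ?l r) s) else 0)"
    by (rule down2_expand[OF young_staircase]) simp
  also have "\<dots> = 0"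
    unfolding sum_double_split using * rem rem2
    by (intro sum.neutral ballI) (auto intro!: sum.neutral)
  finally show ?thesis .
qed

lemma up_power_staircase:
  "(up ^^ (m + 2)) (\<lambda>_. 1) (\<lambda>i. k - i) = (x + y) * (up ^^ m) (\<lambda>_. 1) (\<lambda>i. k - i)"
proof -
  let ?l = "\<lambda>i. k - i"
  have lin: "(up ^^ m) (\<lambda>q. \<phi> q + c * \<psi> q) = (\<lambda>q. (up ^^ m) \<phi> q + c * (up ^^ m) \<psi> q)" for \<phi> \<psi> c
    by (induction m) (auto simp: up_linear)
  have cong: "(up ^^ m) \<phi> q = (up ^^ m) \<psi> q" if "young q" "\<And>q. young q \<Longrightarrow> \<phi> q = \<psi> q" for \<phi> \<psi> q
    using that by (induction m arbitrary: q) (auto intro: up_cong)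
  have "(up ^^ (m + 2)) (\<lambda>_. 1) ?l = (up ^^ m) (up (up (\<lambda>_. 1))) ?l"
    by (simp only: funpow_add o_apply numeral_2_eq_2 funpow.simps id_apply)
  also have "\<dots> = (up ^^ m) (\<lambda>q. down (down (\<lambda>_. 1)) q + (x + y) * 1) ?l"
    by (rule cong[OF young_staircase]) (simp add: up2_minus_down2_one)
  \<comment> \<open>The squared removal is moved outside all copies of \<open>up\<close>, so that it
    is evaluated at the staircase, where it vanishes.\<close>
  also have "\<dots> = down (down ((up ^^ m) (\<lambda>_. 1))) ?l + (x + y) * (up ^^ m) (\<lambda>_. 1) ?l"
    unfolding lin by (simp add: down2_up_power young_staircase)
  finally show ?thesis by (simp add: down2_staircase)
qed

lemma up_staircase:
  "up (\<lambda>_. 1) (\<lambda>i. k - i) = (if k mod 4 = 0 then 1 else if k mod 4 = 1 then x + y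
     else if k mod 4 = 2 then x * y * z else 0)"
proof -
  let ?l = "\<lambda>i. k - i"
  \<comment> \<open>The rows below row \<open>r\<close> have lengths \<open>k - r - 1\<close> down
    to 1. The induction climbs from the empty row \<open>k\<close>.\<close>
  have "below ?l r = (\<Sum>i<k - r. i)" if "r \<le> k" for r
    using that
  proof (induction "k - r" arbitrary: r)
    case 0
    then have e: "{(i, j) \<in> cells ?l. Suc r < i} = {}" by (auto simp: cells_def)
    have "below ?l r = 0" unfolding below_def e by simp
    then show ?case using 0 by simp
  next
    case (Suc m)
    then have m: "k - Suc r = m" "k - r = Suc m" "m = k - Suc r" "Suc r \<le> k" by auto
    show ?case using Suc(1)[OF m(3,4)] below_Suc[OF young_staircase, of k r] by (simp add: m(1,2))
  qed
  then have "up (\<lambda>_. 1) ?l = (\<Sum>r<Suc k. (-1) ^ (\<Sum>i<k - r. i) * wt (Suc r) (Suc (k - r)))"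
    unfolding up_def by (intro sum.cong) (auto simp: addable_def up_coeff_def)
  \<comment> \<open>The new index is the row length \<open>j = k - r\<close>; afterwards
    \<open>k - j\<close> becomes \<open>k + j\<close>, which has the same parity.\<close>
  also have "\<dots> = (\<Sum>j<Suc k. (-1) ^ (\<Sum>i<j. i) * wt (Suc (k - j)) (Suc j))"
    by (subst sum.nat_diff_reindex[symmetric]) (auto intro!: sum.cong)
  also have "\<dots> = (\<Sum>j<Suc k. (-1) ^ (\<Sum>i<j. i) * wt (Suc (k + j)) (Suc j))"
    by (auto simp: wt_def intro!: sum.cong)
  finally have up: "up (\<lambda>_. 1) ?l = (\<Sum>j<Suc k. (-1) ^ (\<Sum>i<j. i) * wt (Suc (k + j)) (Suc j))" .
  define f where "f j = (-1) ^ (\<Sum>i<j. i) * wt (Suc (k + j)) (Suc j)" for j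
  \<comment> \<open>The exponent grows by the odd number \<open>j + (j + 1)\<close> and the parities
    of the cell stay. So four consecutive terms sum to 0 and only \<open>k mod 4\<close>
    matters.\<close>
  have f: "f (Suc (Suc j)) = - f j" for j
    by (simp add: f_def wt_def power_add)
  have "sum f {..<4 * q + m} = sum f {..<m}" for q m
    by (induction q) (auto simp: f numeral_eq_Suc algebra_simps)
  from this[of "k div 4" "Suc (k mod 4)"] have "sum f {..<Suc k} = sum f {..<Suc (k mod 4)}"
    by simp
  then have up': "up (\<lambda>_. 1) ?l = sum f {..<Suc (k mod 4)}"
    by (simp only: up f_def[symmetric])
  consider "k mod 4 = 0" | "k mod 4 = 1" | "k mod 4 = 2" | "k mod 4 = 3" by linarith
  then show ?thesis
  proof cases
    case 1
    then have "even k" by presburger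
    with 1 show ?thesis by (simp add: up' f_def wt_def)
  next
    case 2
    then have "odd k" by presburger
    with 2 show ?thesis by (simp add: up' f_def wt_def)
  next
    case 3
    then have "even k" by presburger
    moreover have "sum f {..<Suc 2} = f 1" by (simp add: f numeral_2_eq_2)
    ultimately show ?thesis using 3 by (simp add: up' f_def wt_def)
  next
    case 4
    moreover have "sum f {..<Suc 3} = 0" by (simp add: f numeral_3_eq_3)
    ultimately show ?thesis by (simp add: up')
  qed
qed

end

section \<open>Removing the largest entry of a tableau\<close>

text \<open>The maximal cells, which are the possible places of the largest entry.\<close>

definition corners :: "(nat \<times> nat) set \<Rightarrow> (nat \<times> nat) set" where
  "corners S = {c \<in> S. \<forall>c'\<in>S. fst c \<le> fst c' \<longrightarrow> snd c \<le> snd c' \<longrightarrow> c' = c}"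

lemma SYT_iff:
  "T \<in> SYT S \<longleftrightarrow> T \<in> extensional S \<and> bij_betw T S {1..card S} \<and>
    (\<forall>c\<in>S. \<forall>c'\<in>S. fst c \<le> fst c' \<longrightarrow> snd c \<le> snd c' \<longrightarrow> T c \<le> T c')"
  by (auto simp: SYT_def)

lemma SYT_le: "T \<in> SYT S \<Longrightarrow> c \<in> S \<Longrightarrow> T c \<le> card S"
  by (auto simp: SYT_iff dest!: bij_betwE)

lemma SYT_extend:
  assumes "finite S" "c \<in> corners S" "T \<in> SYT (S - {c})"
  shows "T(c := card S) \<in> SYT S"
proof -
  have c: "c \<in> S" using assms by (simp add: corners_def)
  then obtain m where m: "card S = Suc m" "card (S - {c}) = m"
    using assms(1) by (metis card_Suc_Diff1)
  have T: "T \<in> extensional (S - {c})" "bij_betw T (S - {c}) {1..m}"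
    "\<And>a b. a \<in> S - {c} \<Longrightarrow> b \<in> S - {c} \<Longrightarrow> fst a \<le> fst b \<Longrightarrow> snd a \<le> snd b \<Longrightarrow> T a \<le> T b"
    using assms(3) m by (auto simp: SYT_iff)
  have "bij_betw (T(c := card S)) ((S - {c}) \<union> {c}) ({1..m} \<union> {Suc m})"
  proof (rule bij_betw_combine)
    show "bij_betw (T(c := card S)) (S - {c}) {1..m}"
      using T(2) by (subst bij_betw_cong[of _ _ T]) auto
  qed (auto simp: m bij_betw_def)
  moreover have "(S - {c}) \<union> {c} = S" "{1..m} \<union> {Suc m} = {1..card S}" using c m by auto
  moreover have "T(c := card S) \<in> extensional S"
    using T(1) c by (auto simp: extensional_def)
  moreover have "(T(c := card S)) a \<le> (T(c := card S)) b"
    if "a \<in> S" "b \<in> S" "fst a \<le> fst b" "snd a \<le> snd b" for a b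
  proof (cases "b = c")
    case True
    then show ?thesis using SYT_le[OF assms(3), of a] that m by auto
  next
    case False
    then have "a \<noteq> c" using assms(2) that by (auto simp: corners_def)
    with False show ?thesis using T(3)[of a b] that by simp
  qed
  ultimately show ?thesis by (simp add: SYT_iff)
qed

lemma SYT_restrict:
  assumes "finite S" "T \<in> SYT S" "c \<in> S" "T c = card S"
  shows "c \<in> corners S" "restrict T (S - {c}) \<in> SYT (S - {c})"
proof -
  obtain m where m: "card S = Suc m" "card (S - {c}) = m"
    using assms by (metis card_Suc_Diff1)
  have T: "T \<in> extensional S" "bij_betw T S {1..card S}"
    "\<And>a b. a \<in> S \<Longrightarrow> b \<in> S \<Longrightarrow> fst a \<le> fst b \<Longrightarrow> snd a \<le> snd b \<Longrightarrow> T a \<le> T b"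
    using assms(2) m by (auto simp: SYT_iff)
  have "c' = c" if "c' \<in> S" "fst c \<le> fst c'" "snd c \<le> snd c'" for c'
    using T(3)[OF assms(3) that] SYT_le[OF assms(2) that(1)] T(2) that(1) assms(3,4)
    by (auto simp: bij_betw_def dest: inj_onD)
  then show "c \<in> corners S" using assms(3) by (auto simp: corners_def)
  have "bij_betw T (S - {c}) ({1..card S} - {T c})"
    using T(2) assms(3) by (auto simp: bij_betw_def inj_on_def)
  moreover have "{1..card S} - {T c} = {1..card (S - {c})}" using m assms(4) by auto
  ultimately have "bij_betw (restrict T (S - {c})) (S - {c}) {1..card (S - {c})}"
    by (subst bij_betw_cong[of _ _ T]) auto
  then show "restrict T (S - {c}) \<in> SYT (S - {c})"
    using T(3) by (auto simp: SYT_iff)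
qed

lemma finite_SYT: assumes "finite S" shows "finite (SYT S)"
proof (rule finite_subset)
  show "SYT S \<subseteq> PiE S (\<lambda>_. {1..card S})"
    by (auto simp: SYT_iff PiE_def dest!: bij_betwE)
qed (use assms in \<open>auto intro: finite_PiE\<close>)

text \<open>Deleting the cell of the largest entry and placing \<open>card S\<close> in a corner are
  mutually inverse.\<close>

lemma sum_SYT_remove_max:
  assumes S: "finite S" "S \<noteq> {}"
  shows "(\<Sum>T\<in>SYT S. f T) = (\<Sum>c\<in>corners S. \<Sum>T\<in>SYT (S - {c}). f (T(c := card S)))"
proof -
  define max_cell where "max_cell T = inv_into S T (card S)" for T :: "nat \<times> nat \<Rightarrow> nat"
  have max_cell: "max_cell T \<in> S" "T (max_cell T) = card S" if "T \<in> SYT S" for T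
  proof -
    have "card S \<in> T ` S" using that S by (auto simp: SYT_iff bij_betw_def Suc_le_eq card_gt_0_iff)
    then show "max_cell T \<in> S" "T (max_cell T) = card S" by (auto simp: max_cell_def inv_into_into f_inv_into_f)
  qed
  have fin: "finite (corners S)" using S by (auto simp: corners_def)
  have "(\<Sum>c\<in>corners S. \<Sum>T\<in>SYT (S - {c}). f (T(c := card S))) =
      (\<Sum>(c, T)\<in>(SIGMA c:corners S. SYT (S - {c})). f (T(c := card S)))"
    using fin S by (subst sum.Sigma) (auto intro: finite_SYT)
  also have "\<dots> = (\<Sum>T\<in>SYT S. f T)"
  proof (rule sum.reindex_bij_witness[of _ "\<lambda>T. (max_cell T, restrict T (S - {max_cell T}))" "\<lambda>(c, T). T(c := card S)"])
    fix p assume p: "p \<in> (SIGMA c:corners S. SYT (S - {c}))"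
    obtain c T where pc: "p = (c, T)" by (cases p)
    then have *: "c \<in> corners S" "c \<in> S" "T \<in> SYT (S - {c})" using p by (auto simp: corners_def)
    let ?T = "T(c := card S)"
    have T: "?T \<in> SYT S" using SYT_extend[OF S(1) *(1,3)] .
    then have inj: "inj_on ?T S" by (auto simp: SYT_iff bij_betw_def)
    have [simp]: "max_cell ?T = c"
      using max_cell[OF T] *(2) by (intro inj_onD[OF inj]) auto
    have "restrict ?T (S - {c}) = T"
      using *(3) by (auto simp: SYT_iff extensional_def fun_eq_iff)
    then show "(max_cell (case p of (c, T) \<Rightarrow> T(c := card S)),
       restrict (case p of (c, T) \<Rightarrow> T(c := card S)) (S - {max_cell (case p of (c, T) \<Rightarrow> T(c := card S))})) = p"
      by (simp add: pc)
    show "(case p of (c, T) \<Rightarrow> T(c := card S)) \<in> SYT S" using T by (simp add: pc)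
  next
    fix T assume T: "T \<in> SYT S"
    have "(restrict T (S - {max_cell T}))(max_cell T := card S) = T"
      using T max_cell[OF T] by (auto simp: fun_eq_iff SYT_iff extensional_def)
    then show "(case (max_cell T, restrict T (S - {max_cell T})) of (c, T) \<Rightarrow> T(c := card S)) = T" by simp
    show "(max_cell T, restrict T (S - {max_cell T})) \<in> (SIGMA c:corners S. SYT (S - {c}))"
      using SYT_restrict[OF S(1) T] max_cell[OF T] by auto
  qed auto
  finally show ?thesis by simp
qed

lemma SYT_empty: "SYT {} = {\<lambda>_. undefined}"
  by (auto simp: SYT_iff bij_betw_def)

text \<open>A cell with the greatest coordinate sum is maximal.\<close>

lemma corners_nonempty:
  assumes "finite S" "S \<noteq> {}" shows "corners S \<noteq> {}"
proof -
  let ?f = "\<lambda>c. fst c + snd c"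
  have "Max (?f ` S) \<in> ?f ` S" using assms by (intro Max_in) auto
  then obtain c where "c \<in> S" "?f c = Max (?f ` S)" by auto
  then have "c \<in> S" "\<And>c'. c' \<in> S \<Longrightarrow> ?f c' \<le> ?f c" using assms by auto
  then have "c \<in> corners S" by (fastforce simp: corners_def prod_eq_iff)
  then show ?thesis by blast
qed

lemma SYT_nonempty: "finite S \<Longrightarrow> SYT S \<noteq> {}"
proof (induction S rule: finite_psubset_induct)
  case (psubset S)
  show ?case
  proof (cases "S = {}")
    case False
    then obtain c where c: "c \<in> corners S" using corners_nonempty[OF psubset(1)] by blast
    then have "SYT (S - {c}) \<noteq> {}" using psubset by (auto simp: corners_def)
    then show ?thesis using SYT_extend[OF psubset(1) c] by blast
  qed (simp add: SYT_empty)
qed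

section \<open>Inversions and signs of skew tableaux\<close>

definition inversion_set :: "(nat \<times> nat) set \<Rightarrow> (nat \<times> nat \<Rightarrow> nat) \<Rightarrow> ((nat \<times> nat) \<times> (nat \<times> nat)) set" where
  "inversion_set S T = {(a, b). a \<in> S \<and> b \<in> S \<and> a \<lhd> b \<and> T a > T b}"

lemma finite_inversion_set: "finite S \<Longrightarrow> finite (inversion_set S T)"
  by (rule finite_subset[of _ "S \<times> S"]) (auto simp: inversion_set_def)

lemma inversion_set_cong: "(\<And>c. c \<in> S \<Longrightarrow> T c = T' c) \<Longrightarrow> inversion_set S T = inversion_set S T'"
  by (auto simp: inversion_set_def)

text \<open>The largest entry is inverted exactly with the cells after its own in reading order,
  always as the first component.\<close>

lemma card_inversion_set_remove_max:
  assumes "finite S" "c \<in> S" and max: "\<And>b. b \<in> S - {c} \<Longrightarrow> T b < T c"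
  shows "card (inversion_set S T) = card {b \<in> S - {c}. c \<lhd> b} + card (inversion_set (S - {c}) T)"
proof -
  have irr: "\<not> c \<lhd> c" by (cases c) auto
  have "inversion_set S T = Pair c ` {b \<in> S - {c}. c \<lhd> b} \<union> inversion_set (S - {c}) T"
    using assms(2) max irr by (auto simp: inversion_set_def dest: less_asym)
  moreover have "card (Pair c ` {b \<in> S - {c}. c \<lhd> b}) = card {b \<in> S - {c}. c \<lhd> b}"
    by (rule card_image) (auto simp: inj_on_def)
  moreover have "Pair c ` {b \<in> S - {c}. c \<lhd> b} \<inter> inversion_set (S - {c}) T = {}"
    by (auto simp: inversion_set_def)
  ultimately show ?thesis
    using assms(1) by (simp add: card_Un_disjoint finite_inversion_set)
qed

text \<open>Agrees with \<open>diamond\<close> on the outer shape. Cell sets replace partition lists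
  so that deleting a corner is a set difference.\<close>

definition glue :: "(nat \<times> nat) set \<Rightarrow> (nat \<times> nat \<Rightarrow> nat) \<Rightarrow> (nat \<times> nat \<Rightarrow> nat) \<Rightarrow> nat \<times> nat \<Rightarrow> nat" where
  "glue A T0 T c = (if c \<in> A then T0 c else T c + card A)"

definition set_sign :: "(nat \<times> nat) set \<Rightarrow> (nat \<times> nat) set \<Rightarrow> (nat \<times> nat \<Rightarrow> nat) \<Rightarrow> int" where
  "set_sign A B T = (let T0 = SOME T0. T0 \<in> SYT A in
     (-1) ^ card (inversion_set A T0) * (-1) ^ card (inversion_set B (glue A T0 T)))"

definition set_imbalance :: "(nat \<times> nat) set \<Rightarrow> (nat \<times> nat) set \<Rightarrow> int" where
  "set_imbalance A B = (\<Sum>T\<in>SYT (B - A). set_sign A B T)"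

lemma skew_sign_eq: "skew_sign \<rho> \<mu> T = set_sign (diagram \<mu>) (diagram \<rho>) T"
proof -
  have sk: "skew \<nu> [] = diagram \<nu>" for \<nu> by (auto simp: skew_def diagram_def)
  have "inversion_set (diagram \<rho>) (diamond \<rho> \<mu> [] T0 T) = inversion_set (diagram \<rho>) (glue (diagram \<mu>) T0 T)" for T0
    by (rule inversion_set_cong) (simp add: diamond_def glue_def sk)
  then show ?thesis
    by (simp add: skew_sign_def set_sign_def straight_sign_def inversions_def inversion_set_def[symmetric] Let_def)
qed

lemma set_sign_remove_max:
  assumes B: "finite B" and A: "A \<subseteq> B" and c: "c \<in> B - A" and T: "T \<in> SYT (B - A - {c})"
  shows "set_sign A B (T(c := card (B - A))) =
    (-1) ^ card {b \<in> B - {c}. c \<lhd> b} * set_sign A (B - {c}) T"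
proof -
  \<comment> \<open>The choice depends on \<open>A\<close> only, so both sides use the same
    auxiliary tableau and its sign is a common factor.\<close>
  define T0 where "T0 = (SOME T0. T0 \<in> SYT A)"
  have T0: "T0 \<in> SYT A"
    unfolding T0_def using SYT_nonempty[OF finite_subset[OF A B]] by (simp add: some_in_eq)
  let ?T = "T(c := card (B - A))"
  have pos: "0 < card (B - A)" using c B by (auto simp: card_gt_0_iff)
  have "glue A T0 ?T b < glue A T0 ?T c" if "b \<in> B - {c}" for b
  proof (cases "b \<in> A")
    case True
    then show ?thesis using SYT_le[OF T0 True] pos c by (simp add: glue_def)
  next
    case False
    then have "T b \<le> card (B - A - {c})" using that by (intro SYT_le[OF T]) auto
    also have "\<dots> < card (B - A)" using c B by (intro psubset_card_mono) auto
    finally show ?thesis using False that c by (auto simp: glue_def)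
  qed
  then have "card (inversion_set B (glue A T0 ?T)) =
      card {b \<in> B - {c}. c \<lhd> b} + card (inversion_set (B - {c}) (glue A T0 ?T))"
    using B c by (intro card_inversion_set_remove_max) auto
  also have "inversion_set (B - {c}) (glue A T0 ?T) = inversion_set (B - {c}) (glue A T0 T)"
    by (rule inversion_set_cong) (auto simp: glue_def)
  finally have eq: "card (inversion_set B (glue A T0 ?T)) =
      card {b \<in> B - {c}. c \<lhd> b} + card (inversion_set (B - {c}) (glue A T0 T))" .
  show ?thesis
    unfolding set_sign_def T0_def[symmetric] Let_def eq by (simp add: power_add)
qed

lemma set_imbalance_remove_max:
  assumes B: "finite B" and A: "A \<subset> B"
  shows "set_imbalance A B =
    (\<Sum>c\<in>corners (B - A). (-1) ^ card {b \<in> B - {c}. c \<lhd> b} * set_imbalance A (B - {c}))"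
proof -
  have "set_imbalance A B =
      (\<Sum>c\<in>corners (B - A). \<Sum>T\<in>SYT (B - A - {c}). set_sign A B (T(c := card (B - A))))"
    unfolding set_imbalance_def using A B by (intro sum_SYT_remove_max) auto
  also have "\<dots> = (\<Sum>c\<in>corners (B - A). (-1) ^ card {b \<in> B - {c}. c \<lhd> b} *
      (\<Sum>T\<in>SYT (B - A - {c}). set_sign A (B - {c}) T))"
    unfolding sum_distrib_left using A B
    by (intro sum.cong refl set_sign_remove_max) (auto simp: corners_def)
  also have "\<dots> = (\<Sum>c\<in>corners (B - A). (-1) ^ card {b \<in> B - {c}. c \<lhd> b} * set_imbalance A (B - {c}))"
    by (simp add: set_imbalance_def Diff_insert2[symmetric] Diff_insert[symmetric] insert_commute)
  finally show ?thesis .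
qed

text \<open>The sign of the auxiliary tableau occurs twice and squares to 1.\<close>

lemma set_imbalance_self: "set_imbalance A A = 1"
proof -
  have "inversion_set A (glue A T0 T) = inversion_set A T0" for T0 T
    by (rule inversion_set_cong) (simp add: glue_def)
  then show ?thesis
    by (simp add: set_imbalance_def SYT_empty set_sign_def Let_def power_mult_distrib[symmetric])
qed

section \<open>Growing a Young diagram cell by cell\<close>

lemma cells_subset_iff: "cells a \<subseteq> cells l \<longleftrightarrow> (\<forall>i. a i \<le> l i)"
proof
  assume sub: "cells a \<subseteq> cells l"
  show "\<forall>i. a i \<le> l i"
  proof
    fix i
    show "a i \<le> l i"
    proof (cases "a i = 0")
      case False
      then have "(Suc i, a i) \<in> cells a" by (simp add: cells_def)
      from subsetD[OF sub this] show ?thesis by (simp add: cells_def)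
    qed simp
  qed
next
  assume "\<forall>i. a i \<le> l i"
  then have "j \<le> l i" if "j \<le> a i" for i j using that order_trans by blast
  then show "cells a \<subseteq> cells l" by (auto simp: cells_def)
qed

lemma cells_dec: "0 < l r \<Longrightarrow> cells (dec l r) = cells l - {(Suc r, l r)}"
  by (auto simp: cells_def dec_def split: if_splits)

text \<open>A corner ends its row of \<open>l\<close>, and the row below is shorter: otherwise the
  cell underneath would belong to \<open>l\<close>, and it lies outside \<open>a\<close> because
  \<open>a\<close> is weakly decreasing.\<close>

lemma corners_cells:
  assumes l: "young l" and a: "young a"
  shows "corners (cells l - cells a) = (\<lambda>r. (Suc r, l r)) ` {r \<in> removable l. a r < l r}"
proof (intro equalityI subsetI)
  fix c assume c: "c \<in> corners (cells l - cells a)"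
  obtain i j where ij: "c = (i, j)" by (cases c)
  have cS: "1 \<le> i" "1 \<le> j" "j \<le> l (i - 1)" "a (i - 1) < j"
    using c by (auto simp: corners_def ij cells_def)
  have max: "c' = c" if "c' \<in> cells l - cells a" "i \<le> fst c'" "j \<le> snd c'" for c'
    using c that by (auto simp: corners_def ij)
  have j: "j = l (i - 1)"
    using max[of "(i, l (i - 1))"] cS by (auto simp: cells_def ij)
  have "\<not> l (i - 1) \<le> l i"
  proof
    assume "l (i - 1) \<le> l i"
    moreover have "a i \<le> a (i - 1)" using youngD[OF a, of "i - 1" i] by simp
    ultimately show False using max[of "(Suc i, j)"] cS by (auto simp: cells_def ij)
  qed
  then show "c \<in> (\<lambda>r. (Suc r, l r)) ` {r \<in> removable l. a r < l r}"
    using cS j by (intro image_eqI[of _ _ "i - 1"]) (auto simp: ij removable_def)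
next
  fix c assume "c \<in> (\<lambda>r. (Suc r, l r)) ` {r \<in> removable l. a r < l r}"
  then obtain r where r: "c = (Suc r, l r)" "r \<in> removable l" "a r < l r" by auto
  have "(i, j) = c" if "(i, j) \<in> cells l" "Suc r \<le> i" "l r \<le> j" for i j
  proof (cases "i = Suc r")
    case False
    then have "l (i - 1) \<le> l (Suc r)" using that by (intro youngD[OF l]) auto
    then show ?thesis using that r by (auto simp: cells_def removable_def)
  qed (use that r in \<open>auto simp: cells_def\<close>)
  then show "c \<in> corners (cells l - cells a)"
    using r by (auto simp: corners_def cells_def)
qed

definition weight :: "'a \<Rightarrow> 'a \<Rightarrow> 'a \<Rightarrow> (nat \<Rightarrow> nat) \<Rightarrow> (nat \<Rightarrow> nat) \<Rightarrow> 'a::comm_ring_1" where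
  "weight x y z a l = (\<Prod>(i, j)\<in>cells l - cells a. wt x y z i j) * of_int (set_imbalance (cells a) (cells l))"

definition over :: "(nat \<Rightarrow> nat) \<Rightarrow> nat \<Rightarrow> (nat \<Rightarrow> nat) set" where
  "over a n = {l. young l \<and> (\<forall>i. a i \<le> l i) \<and> card (cells l - cells a) = n}"

lemma weight_step:
  assumes a: "young a" and l: "l \<in> over a (Suc n)"
  shows "weight x y z a l =
    (\<Sum>r | r \<in> removable l \<and> a r < l r. up_coeff x y z (dec l r) r * weight x y z a (dec l r))"
proof -
  have yl: "young l" and al: "\<And>i. a i \<le> l i" and card: "card (cells l - cells a) = Suc n"
    using l by (auto simp: over_def)
  have sub: "cells a \<subset> cells l" using al card by (auto simp: psubset_eq cells_subset_iff)
  have fin: "finite (cells l)" using finite_cells[OF yl] .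
  \<comment> \<open>The removed cell ends its row, so the later cells in reading order are those of
    the lower rows. This turns the inversion count into \<open>below\<close>.\<close>
  have bel: "{b \<in> cells l - {(Suc r, l r)}. (Suc r, l r) \<lhd> b} = {(i, j) \<in> cells (dec l r). Suc r < i}"
    if "r \<in> removable l" for r
    unfolding cells_dec[of l r, OF removable_pos[OF that]] by (auto simp: cells_def)
  have imb: "set_imbalance (cells a) (cells l) =
      (\<Sum>r | r \<in> removable l \<and> a r < l r. (-1) ^ below (dec l r) r * set_imbalance (cells a) (cells (dec l r)))"
    unfolding set_imbalance_remove_max[OF fin sub] corners_cells[OF yl a]
    by (rule sum.reindex_cong[OF _ refl])
       (simp_all only: mem_Collect_eq bel below_def cells_dec removable_pos, auto simp: inj_on_def)
  have prd: "(\<Prod>(i, j)\<in>cells l - cells a. wt x y z i j) =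
      wt x y z (Suc r) (Suc (dec l r r)) * (\<Prod>(i, j)\<in>cells (dec l r) - cells a. wt x y z i j)"
    if r: "r \<in> removable l" "a r < l r" for r
  proof -
    have c: "(Suc r, l r) \<in> cells l - cells a" using r by (auto simp: cells_def)
    have "cells l - cells a - {(Suc r, l r)} = cells (dec l r) - cells a"
      using r by (auto simp: cells_dec)
    then show ?thesis using fin r prod.remove[OF _ c, of "\<lambda>(i, j). wt x y z i j"]
      by (simp add: dec_same)
  qed
  show ?thesis
    unfolding weight_def imb of_int_sum sum_distrib_left
  proof (rule sum.cong[OF refl])
    fix r assume "r \<in> {r. r \<in> removable l \<and> a r < l r}"
    then have "r \<in> removable l" "a r < l r" by auto
    from prd[OF this] show "(\<Prod>(i, j)\<in>cells l - cells a. wt x y z i j) *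
        of_int ((- 1) ^ below (dec l r) r * set_imbalance (cells a) (cells (dec l r))) =
      up_coeff x y z (dec l r) r * ((\<Prod>(i, j)\<in>cells (dec l r) - cells a. wt x y z i j) *
        of_int (set_imbalance (cells a) (cells (dec l r))))"
      by (simp add: up_coeff_def mult_ac)
  qed
qed

lemma weight_self: "weight x y z a a = 1"
  by (simp add: weight_def set_imbalance_self)

lemma over_0: assumes "young a" shows "over a 0 = {a}"
proof -
  have "l = a" if "young l" "\<forall>i. a i \<le> l i" "card (cells l - cells a) = 0" for l
  proof -
    have "cells l \<subseteq> cells a" using that finite_cells[of l] by auto
    then show ?thesis using that(2) by (auto simp: cells_subset_iff fun_eq_iff intro: antisym)
  qed
  then show ?thesis using assms by (auto simp: over_def)
qed

lemma inc_over:
  assumes a: "young a" and l: "l \<in> over a n" and r: "r \<in> addable l"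
  shows "inc l r \<in> over a (Suc n)" "r \<in> removable (inc l r)" "a r < inc l r r"
proof -
  have yl: "young l" and al: "\<And>i. a i \<le> l i" and card: "card (cells l - cells a) = n"
    using l by (auto simp: over_def)
  have n: "(Suc r, Suc (l r)) \<notin> cells l" "(Suc r, Suc (l r)) \<notin> cells a"
    using al[of r] by (auto simp: cells_def)
  have "cells (inc l r) - cells a = insert (Suc r, Suc (l r)) (cells l - cells a)"
    using n by (auto simp: cells_inc)
  then have "card (cells (inc l r) - cells a) = Suc n"
    using card n finite_cells[OF yl] by simp
  then show "inc l r \<in> over a (Suc n)"
    using young_inc[OF yl r] al by (auto simp: over_def inc_def intro: le_SucI)
  show "r \<in> removable (inc l r)" using removable_inc[OF yl] .
  show "a r < inc l r r" using al[of r] by (simp add: inc_same)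
qed

lemma dec_over:
  assumes l: "l \<in> over a (Suc n)" and r: "r \<in> removable l" "a r < l r"
  shows "dec l r \<in> over a n" "r \<in> addable (dec l r)"
proof -
  have yl: "young l" and al: "\<And>i. a i \<le> l i" and card: "card (cells l - cells a) = Suc n"
    using l by (auto simp: over_def)
  have c: "(Suc r, l r) \<in> cells l - cells a" using r by (auto simp: cells_def)
  have "cells (dec l r) - cells a = (cells l - cells a) - {(Suc r, l r)}"
    using r by (auto simp: cells_dec)
  then have "card (cells (dec l r) - cells a) = n"
    using card c finite_cells[OF yl] by simp
  then show "dec l r \<in> over a n"
    using young_dec[OF yl r(1)] al r by (auto simp: over_def dec_def)
  show "r \<in> addable (dec l r)" using addable_dec[OF yl r(1)] .
qed

lemma finite_over:
  assumes a: "young a" shows "finite (over a n)"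
proof (induction n)
  case (Suc n)
  have "over a (Suc n) \<subseteq> (\<lambda>(l, r). inc l r) ` (SIGMA l:over a n. addable l)"
  proof
    fix l assume l: "l \<in> over a (Suc n)"
    then have "card (cells l - cells a) = Suc n" "young l" by (auto simp: over_def)
    then have "cells l - cells a \<noteq> {}" by (metis card.empty Zero_not_Suc)
    then have "corners (cells l - cells a) \<noteq> {}"
      using finite_cells[OF \<open>young l\<close>] by (intro corners_nonempty) auto
    then obtain r where r: "r \<in> removable l" "a r < l r"
      using corners_cells[OF \<open>young l\<close> a] by auto
    show "l \<in> (\<lambda>(l, r). inc l r) ` (SIGMA l:over a n. addable l)"
      using dec_over[OF l r] inc_dec[of l r] r
      by (intro image_eqI[of _ _ "(dec l r, r)"]) (auto simp: removable_pos)
  qed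
  moreover have "finite (SIGMA l:over a n. addable l)"
    using Suc by (intro finite_SigmaI finite_addable) (auto simp: over_def)
  ultimately show ?case by (metis finite_imageI finite_subset)
qed (simp add: over_0[OF a])

text \<open>Stated for every \<phi> so that the induction can absorb the last added cell into the
  function: level \<open>Suc n\<close> with \<phi> becomes level \<open>n\<close> with
  \<open>up x y z \<phi>\<close>.\<close>

lemma sum_over_weight:
  assumes a: "young a"
  shows "(\<Sum>l\<in>over a n. weight x y z a l * \<phi> l) = (up x y z ^^ n) \<phi> a"
proof (induction n arbitrary: \<phi>)
  case 0
  show ?case by (simp add: over_0[OF a] weight_self)
next
  case (Suc n)
  let ?R = "\<lambda>l. {r. r \<in> removable l \<and> a r < l r}"
  have finR: "finite (?R l)" if "l \<in> over a m" for l m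
    using that finite_removable[of l] by (auto simp: over_def)
  have "(\<Sum>l\<in>over a (Suc n). weight x y z a l * \<phi> l) =
      (\<Sum>l\<in>over a (Suc n). \<Sum>r\<in>?R l. up_coeff x y z (dec l r) r * weight x y z a (dec l r) * \<phi> l)"
    by (simp add: weight_step[OF a] sum_distrib_right cong: sum.cong)
  also have "\<dots> = (\<Sum>(l, r)\<in>(SIGMA l:over a (Suc n). ?R l).
      up_coeff x y z (dec l r) r * weight x y z a (dec l r) * \<phi> l)"
    using finR by (intro sum.Sigma finite_over[OF a]) blast
  \<comment> \<open>A larger shape with a removable row exceeding \<open>a\<close> corresponds to a
    smaller shape with an addable row.\<close>
  also have "\<dots> = (\<Sum>(l, r)\<in>(SIGMA l:over a n. addable l).
      weight x y z a l * (up_coeff x y z l r * \<phi> (inc l r)))"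
    by (rule sum.reindex_bij_witness[of _ "\<lambda>(l, r). (inc l r, r)" "\<lambda>(l, r). (dec l r, r)"])
       (auto simp: inc_dec dec_inc removable_pos inc_over[OF a] dec_over algebra_simps
             dest: inc_over[OF a])
  also have "\<dots> = (\<Sum>l\<in>over a n. weight x y z a l * up x y z \<phi> l)"
    unfolding up_def sum_distrib_left
    by (intro sum.Sigma[symmetric] finite_over[OF a] ballI finite_addable) (auto simp: over_def)
  also have "\<dots> = (up x y z ^^ Suc n) \<phi> a"
    by (simp add: Suc funpow_swap1)
  finally show ?case .
qed

section \<open>From row-length functions to partition lists\<close>

definition row_length :: "nat list \<Rightarrow> nat \<Rightarrow> nat" where
  "row_length \<rho> i = (if i < length \<rho> then \<rho> ! i else 0)"

lemma diagram_eq_cells: "diagram \<rho> = cells (row_length \<rho>)"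
  by (auto simp: diagram_def cells_def row_length_def split: if_splits)

lemma young_row_length:
  assumes "partition \<rho>" shows "young (row_length \<rho>)"
proof (rule youngI[of _ "length \<rho>"])
  fix i show "row_length \<rho> (Suc i) \<le> row_length \<rho> i"
    using assms by (auto simp: partition_def row_length_def sorted_wrt_iff_nth_less)
qed (simp add: row_length_def)

lemma bij_row_length: "bij_betw row_length {\<rho>. partition \<rho>} {l. young l}"
proof (rule bij_betwI')
  fix \<rho> \<sigma> assume p: "\<rho> \<in> {\<rho>. partition \<rho>}" "\<sigma> \<in> {\<rho>. partition \<rho>}"
  \<comment> \<open>Partition lists contain no 0, so the row lengths determine the length of the
    list.\<close>
  have len: "i < length \<tau> \<longleftrightarrow> row_length \<tau> i \<noteq> 0" if "partition \<tau>" for \<tau> i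
    using that nth_mem[of i \<tau>] unfolding partition_def row_length_def by metis
  show "row_length \<rho> = row_length \<sigma> \<longleftrightarrow> \<rho> = \<sigma>"
  proof
    assume eq: "row_length \<rho> = row_length \<sigma>"
    have iff: "i < length \<rho> \<longleftrightarrow> i < length \<sigma>" for i
      using p len[of \<rho> i] len[of \<sigma> i] unfolding mem_Collect_eq eq by blast
    have le: "length \<rho> = length \<sigma>" using iff[of "length \<rho>"] iff[of "length \<sigma>"] by simp
    show "\<rho> = \<sigma>"
    proof (rule nth_equalityI[OF le])
      fix i assume "i < length \<rho>"
      then show "\<rho> ! i = \<sigma> ! i" using fun_cong[OF eq, of i] le by (simp add: row_length_def)
    qed
  qed simp
next
  fix l assume "l \<in> {l. young l}"
  then have l: "young l" by simp
  \<comment> \<open>The first empty row gives the length of the list.\<close>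
  define n where "n = (LEAST n. l n = 0)"
  have "l n = 0" using LeastI_ex[of "\<lambda>n. l n = 0"] l by (simp add: young_def n_def)
  then have ge: "l i = 0" if "n \<le> i" for i using youngD[OF l that] by simp
  have lt: "l i \<noteq> 0" if "i < n" for i
    using not_less_Least[of i "\<lambda>n. l n = 0"] that by (simp add: n_def)
  have "row_length (map l [0..<n]) = l" using ge by (auto simp: row_length_def fun_eq_iff)
  moreover have "partition (map l [0..<n])"
    using youngD[OF l] by (auto simp: partition_def sorted_wrt_iff_nth_less dest: lt)
  ultimately show "\<exists>\<rho>\<in>{\<rho>. partition \<rho>}. l = row_length \<rho>" by force
qed (simp add: young_row_length)

lemma monomial_eq_prod:
  assumes "finite S"
  shows "x ^ v_stat S * y ^ h_stat S * z ^ d_stat S = (\<Prod>(i, j)\<in>S. wt x y z i j)"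
proof -
  have pw: "(\<Prod>c\<in>S. if P c then t else 1) = t ^ card {c \<in> S. P c}" for P and t :: 'a
    using assms by (simp add: prod.inter_filter[symmetric])
  \<comment> \<open>A cell in an even row and an even column counts in all three statistics, so
    \<open>wt\<close> splits into three parity factors.\<close>
  have "(\<Prod>(i, j)\<in>S. wt x y z i j) = (\<Prod>c\<in>S. if even (fst c) then x else 1) *
     (\<Prod>c\<in>S. if even (snd c) then y else 1) * (\<Prod>c\<in>S. if even (fst c) \<and> even (snd c) then z else 1)"
    by (simp add: prod.distrib[symmetric] wt_def case_prod_beta)
  moreover have "{(i, j) \<in> S. even i} = {c \<in> S. even (fst c)}"
    "{(i, j) \<in> S. even j} = {c \<in> S. even (snd c)}"
    "{(i, j) \<in> S. even i \<and> even j} = {c \<in> S. even (fst c) \<and> even (snd c)}" by auto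
  ultimately show ?thesis by (simp only: pw v_stat_def h_stat_def d_stat_def)
qed

lemma F_poly_eq_up:
  assumes "partition \<alpha>"
  shows "F_poly \<alpha> n x y z = (up x y z ^^ n) (\<lambda>_. 1) (row_length \<alpha>)"
proof -
  let ?a = "row_length \<alpha>"
  let ?P = "{\<rho>. partition \<rho> \<and> diagram \<alpha> \<subseteq> diagram \<rho> \<and> card (skew \<rho> \<alpha>) = n}"
  have bij: "bij_betw row_length ?P (over ?a n)"
  proof (rule bij_betw_subset[OF bij_row_length])
    show "row_length ` ?P = over ?a n"
      using bij_betw_imp_surj_on[OF bij_row_length]
      by (force simp: over_def skew_def diagram_eq_cells cells_subset_iff)
  qed auto
  have "x ^ v_stat (skew \<rho> \<alpha>) * y ^ h_stat (skew \<rho> \<alpha>) * z ^ d_stat (skew \<rho> \<alpha>) *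
      of_int (sign_imbalance \<rho> \<alpha>) = weight x y z ?a (row_length \<rho>)" if "partition \<rho>" for \<rho>
  proof -
    have fin: "finite (cells (row_length \<rho>) - cells ?a)"
      using finite_cells[OF young_row_length[OF that]] by auto
    then show ?thesis
      by (simp add: weight_def monomial_eq_prod[OF fin] skew_def sign_imbalance_def set_imbalance_def
          skew_sign_eq diagram_eq_cells)
  qed
  then have "F_poly \<alpha> n x y z = (\<Sum>\<rho>\<in>?P. weight x y z ?a (row_length \<rho>) * 1)"
    unfolding F_poly_def by (intro sum.cong) auto
  also have "\<dots> = (\<Sum>l\<in>over ?a n. weight x y z ?a l * 1)"
    by (rule sum.reindex_bij_betw[OF bij])
  also have "\<dots> = (up x y z ^^ n) (\<lambda>_. 1) ?a"
    by (rule sum_over_weight[OF young_row_length[OF assms]])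
  finally show ?thesis .
qed

lemma partition_staircase: "partition (staircase k)"
  by (simp add: partition_def staircase_def sorted_wrt_rev del: upt_Suc)

lemma row_length_staircase: "row_length (staircase k) = (\<lambda>i. k - i)"
  by (auto simp: row_length_def staircase_def fun_eq_iff rev_nth simp del: upt_Suc)

theorem theorem4p13:
  fixes k n :: nat and x y z :: "'a::comm_ring_1"
  shows "F_poly (staircase k) (2 * n) x y z = (x + y) ^ n \<and>
    F_poly (staircase k) (2 * n + 1) x y z =
      (if k mod 4 = 0 then (x + y) ^ n
       else if k mod 4 = 1 then (x + y) ^ (n + 1)
       else if k mod 4 = 2 then x * y * z * (x + y) ^ n
       else 0)"
proof -
  let ?F = "\<lambda>m. F_poly (staircase k) m x y z"
  have F: "?F m = (up x y z ^^ m) (\<lambda>_. 1) (\<lambda>i. k - i)" for m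
    using F_poly_eq_up[OF partition_staircase] by (simp add: row_length_staircase)
  \<comment> \<open>Each two applications of \<open>up\<close> contribute a factor
    \<open>x + y\<close> at the staircase, which leaves the cases \<open>m = 0\<close> and
    \<open>m = 1\<close>.\<close>
  have rec: "?F (2 * n + m) = (x + y) ^ n * ?F m" for m
  proof (induction n)
    case (Suc n)
    have "2 * Suc n + m = (2 * n + m) + 2" by simp
    then show ?case using Suc up_power_staircase[where x=x and y=y and z=z and m="2 * n + m" and k=k]
      by (simp only: F power_Suc mult.assoc)
  qed simp
  have "?F 0 = 1" by (simp add: F)
  moreover have "?F 1 = (if k mod 4 = 0 then 1 else if k mod 4 = 1 then x + y
     else if k mod 4 = 2 then x * y * z else 0)"
    using up_staircase[where x=x and y=y and z=z and k=k] by (simp add: F)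
  ultimately show ?thesis
    using rec[of 0] rec[of 1] by (auto simp: mult.commute)
qed

end
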